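(* Let $\mathbb{F}$ be an algebraically closed field of characteristic $2$. The automorphism groups of the $2$-dimensional evolution algebras $E_1(b,c)$ ($b,c\in\mathbb{F}$, $bc\ne1$), $E_2(b)$ ($b\in\mathbb{F}$), $E_3$, $E_4$, $E_5$, $E_6$ over $\mathbb{F}$ are as follows, where $I$ is the $2\times2$ identity matrix: \begin{itemize} \item $Aut(E_1(b,c))=\{I\}$ if $b\neq c$; \item $Aut(E_1(b,b))=\left\{I,\begin{pmatrix}0&1\\1&0\end{pmatrix}\right\}$ if $b^2\neq 1$; \item $Aut(E_2(b))=\{I\}$ if $b\neq 0$; \item $Aut(E_2(0))=\left\{\begin{pmatrix}1&0\\t&1-t\end{pmatrix}: t\in\mathbb{F},\ t\neq 1\right\}$; \item $Aut(E_3)=\left\{I,\begin{pmatrix}0&1\\1&0\end{pmatrix},\begin{pmatrix}t&0\\0&t^2\end{pmatrix},\begin{pmatrix}t^2&0\\0&t\end{pmatrix},\begin{pmatrix}0&t\\t^2&0\end{pmatrix},\begin{pmatrix}0&t^2\\t&0\end{pmatrix}\right\}$, where $t\in\mathbb{F}$ is an element with $t^2+t+1=0$; \item $Aut(E_4)=\{I\}$; \item $Aut(E_5)=\left\{\begin{pmatrix}t&1-t\\1-t&t\end{pmatrix}: t\in\mathbb{F}\right\}$; \item $Aut(E_6)=\left\{\begin{pmatrix}t^2&s\\0&t\end{pmatrix}: t,s\in\mathbb{F},\ t\neq0\right\}$. \end{itemize}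
   Context: A $2$-dimensional algebra over $\mathbb{F}$ with basis $(e_1,e_2)$ and $e_i\cdot e_j=A^1_{i,j}e_1+A^2_{i,j}e_2$ is identified with its matrix of structure constants $$A=\begin{pmatrix} A^1_{1,1}&A^1_{1,2}&A^1_{2,1}&A^1_{2,2}\\ A^2_{1,1}&A^2_{1,2}&A^2_{2,1}&A^2_{2,2}\end{pmatrix},$$ so that in coordinate column vectors the product of $u$ and $v$ is $A(u\otimes v)$ (Kronecker product). The algebras considered (up to isomorphism, all the nontrivial $2$-dimensional evolution algebras over $\mathbb{F}$, i.e. algebras with nonzero multiplication having a basis with $e_1e_2=e_2e_1=0$) are $$E_{1}(b,c)=\begin{pmatrix} 1 & 0 & 0 & b\\ c & 0 & 0 & 1\end{pmatrix}\ (bc\neq1),\quad E_{2}(b)=\begin{pmatrix} 1 & 0 & 0 & b\\ 1 & 0 & 0 & 0\end{pmatrix},\quad E_{3}=\begin{pmatrix} 0 & 0 & 0 & 1\\ 1 & 0 & 0 & 0\end{pmatrix},$$ $$E_{4}=\begin{pmatrix} 1 & 0 & 0 & 1\\ 0 & 0 & 0 & 0\end{pmatrix},\quad E_5=\begin{pmatrix} 1 & 0 & 0 & -1\\ -1 & 0 & 0 & 1\end{pmatrix},\quad E_{6}=\begin{pmatrix} 0 & 0 & 0 & 1\\ 0 & 0 & 0 & 0\end{pmatrix}.$$ For an algebra with matrix of structure constants $E$, its automorphism group is $Aut(E)=\{g\in GL(2,\mathbb{F}):\ gE-E(g\otimes g)=0\}$. *)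

theory Defs
  imports "HOL-Analysis.Analysis"
begin

text \<open>
  The four columns of a matrix of structure constants, and the rows and columns of a Kronecker
  product of two 2-by-2 matrices, belong to the pairs (1,1), (1,2), (2,1), (2,2), in this order.
  In the type \<^typ>\<open>4\<close> the numeral 4 equals 0, so the last branch below is the one for 4.
\<close>

definition pair_of :: "4 \<Rightarrow> 2 \<times> 2" where
  "pair_of p = (if p = 1 then (1, 1) else if p = 2 then (1, 2) else if p = 3 then (2, 1) else (2, 2))"

definition kronecker :: "'a::times^2^2 \<Rightarrow> 'a^2^2 \<Rightarrow> 'a^4^4" (infixl "\<otimes>\<^sub>K" 75) where
  "g \<otimes>\<^sub>K h = (\<chi> p q. g $ fst (pair_of p) $ fst (pair_of q) * h $ snd (pair_of p) $ snd (pair_of q))"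

definition Aut :: "'a::field^4^2 \<Rightarrow> ('a^2^2) set" where
  "Aut E = {g. invertible g \<and> g ** E - E ** (g \<otimes>\<^sub>K g) = 0}"

text \<open>
  Matrices are written row by row. The condition \<open>b * c \<noteq> 1\<close> on the parameters
  of \<open>E\<^sub>1\<close> is not part of the definition.
\<close>

definition E\<^sub>1 :: "'a::field \<Rightarrow> 'a \<Rightarrow> 'a^4^2" where
  "E\<^sub>1 b c = vector [vector [1, 0, 0, b], vector [c, 0, 0, 1]]"

definition E\<^sub>2 :: "'a::field \<Rightarrow> 'a^4^2" where
  "E\<^sub>2 b = vector [vector [1, 0, 0, b], vector [1, 0, 0, 0]]"

definition E\<^sub>3 :: "'a::field^4^2" where
  "E\<^sub>3 = vector [vector [0, 0, 0, 1], vector [1, 0, 0, 0]]"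

definition E\<^sub>4 :: "'a::field^4^2" where
  "E\<^sub>4 = vector [vector [1, 0, 0, 1], vector [0, 0, 0, 0]]"

definition E\<^sub>5 :: "'a::field^4^2" where
  "E\<^sub>5 = vector [vector [1, 0, 0, - 1], vector [- 1, 0, 0, 1]]"

definition E\<^sub>6 :: "'a::field^4^2" where
  "E\<^sub>6 = vector [vector [0, 0, 0, 1], vector [0, 0, 0, 0]]"

definition mat2 :: "'a::zero \<Rightarrow> 'a \<Rightarrow> 'a \<Rightarrow> 'a \<Rightarrow> 'a^2^2" where
  "mat2 a b c d = vector [vector [a, b], vector [c, d]]"

lemma vector_4 [simp]:
  "(vector [w, x, y, z] :: 'a::zero^4) $ 1 = w"
  "(vector [w, x, y, z] :: 'a::zero^4) $ 2 = x"
  "(vector [w, x, y, z] :: 'a::zero^4) $ 3 = y"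
  "(vector [w, x, y, z] :: 'a::zero^4) $ 4 = z"
  unfolding vector_def by simp_all

end

theory Submission
  imports Defs
begin

text \<open>
  Compare the images of the products \<open>e\<^sub>ie\<^sub>j\<close>. If the multiplication is nondegenerate
  (\<open>E\<^sub>1\<close>, \<open>E\<^sub>2 b\<close> with \<open>b \<noteq> 0\<close>, \<open>E\<^sub>3\<close>), the relation
  \<open>e\<^sub>1e\<^sub>2 = 0\<close> forces an automorphism to be a monomial matrix, whose nonzero entries are then
  given by equations in one variable. In the degenerate cases the relations can be solved directly,
  using that squaring is additive and injective in characteristic 2.
\<close>

lemma mat2_nth [simp]:
  "mat2 p q r s $ 1 $ 1 = p" "mat2 p q r s $ 1 $ 2 = q"
  "mat2 p q r s $ 2 $ 1 = r" "mat2 p q r s $ 2 $ 2 = s"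
  by (simp_all add: mat2_def)

lemma mat2_eq_iff [simp]:
  "mat2 p q r s = mat2 p' q' r' s' \<longleftrightarrow> p = p' \<and> q = q' \<and> r = r' \<and> s = s'"
  by (auto simp: vec_eq_iff forall_2)

lemma mat_1_eq_mat2: "mat 1 = mat2 1 0 0 1"
  by (simp add: vec_eq_iff forall_2 mat_def)

lemma mat2_collapse: "mat2 (g $ 1 $ 1) (g $ 1 $ 2) (g $ 2 $ 1) (g $ 2 $ 2) = g"
  by (simp add: vec_eq_iff forall_2)

text \<open>Every matrix is the \<open>mat2\<close> of its entries, so sets of matrices can be
  compared with the four entries as free variables.\<close>

lemma mat2_set_eqI:
  assumes "\<And>p q r s. mat2 p q r s \<in> A \<longleftrightarrow> mat2 p q r s \<in> B"
  shows "A = B"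
  using assms mat2_collapse by (metis set_eqI)

lemma pair_of_simps [simp]:
  "pair_of 1 = (1, 1)" "pair_of 2 = (1, 2)" "pair_of 3 = (2, 1)" "pair_of 4 = (2, 2)"
  by (simp_all add: pair_of_def)

text \<open>The columns of the matrix identity compare g(e_i e_j) with g(e_i) g(e_j): column (1,1)
  gives the first and third equations, column (2,2) the second and fourth. Columns (1,2) and (2,1)
  agree by commutativity and give the last two.\<close>

lemma mat2_mem_Aut_evolution_iff:
  fixes a b c d :: "'a::field"
  shows "mat2 p q r s \<in> Aut (vector [vector [a, 0, 0, b], vector [c, 0, 0, d]]) \<longleftrightarrow>
    p * s \<noteq> q * r \<and>
    a * p\<^sup>2 + b * r\<^sup>2 = a * p + c * q \<and> a * q\<^sup>2 + b * s\<^sup>2 = b * p + d * q \<and>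
    c * p\<^sup>2 + d * r\<^sup>2 = a * r + c * s \<and> c * q\<^sup>2 + d * s\<^sup>2 = b * r + d * s \<and>
    a * p * q + b * r * s = 0 \<and> c * p * q + d * r * s = 0"
  unfolding Aut_def
  by (auto simp: invertible_det_nz det_2 vec_eq_iff forall_2 forall_4 matrix_matrix_mult_def
      sum_2 sum_4 kronecker_def power2_eq_square algebra_simps)

lemmas mem_Aut_simps =
  mat2_mem_Aut_evolution_iff[of _ _ _ _ 1 b c 1 for b c, folded E\<^sub>1_def]
  mat2_mem_Aut_evolution_iff[of _ _ _ _ 1 b 1 0 for b, folded E\<^sub>2_def]
  mat2_mem_Aut_evolution_iff[of _ _ _ _ 0 1 1 0, folded E\<^sub>3_def]
  mat2_mem_Aut_evolution_iff[of _ _ _ _ 1 1 0 0, folded E\<^sub>4_def]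
  mat2_mem_Aut_evolution_iff[of _ _ _ _ 1 "-1" "-1" 1, folded E\<^sub>5_def]
  mat2_mem_Aut_evolution_iff[of _ _ _ _ 0 1 0 0, folded E\<^sub>6_def]

text \<open>The assumption yields t + t^2 = -1 and t^3 = 1, so X^3 - 1 splits with roots 1, t,
  t^2.\<close>

lemma root_of_unity_quadratic_cube:
  fixes t :: "'a::field"
  assumes "t\<^sup>2 + t + 1 = 0"
  shows "x ^ 3 = 1 \<longleftrightarrow> x = 1 \<or> x = t \<or> x = t\<^sup>2"
proof -
  have "x ^ 3 - 1 = (x - 1) * ((x - t) * (x - t\<^sup>2))"
    using assms by algebra
  then show ?thesis by (metis eq_iff_diff_eq_0 mult_eq_0_iff)
qed

text \<open>Algebraic closedness enters here. This existence keeps the clause on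
  \<open>E\<^sub>3\<close>, quantified over all such t, from being vacuous.\<close>

lemma alg_closed_primitive_cube_root:
  "\<exists>t :: 'a::alg_closed_field. t\<^sup>2 + t + 1 = 0"
proof -
  obtain t where "poly [:1, 1, 1 :: 'a:] t = 0"
    using alg_closed_imp_poly_has_root[of "[:1, 1, 1 :: 'a:]"] by auto
  then show ?thesis
    by (intro exI[of _ t]) (simp add: power2_eq_square algebra_simps)
qed

lemma CHAR_2_uminus_eq:
  assumes "CHAR('a::comm_ring_1) = 2"
  shows "- x = (x :: 'a)"
proof -
  have "(2 :: 'a) = 0"
    using of_nat_CHAR[where 'a = 'a] assms by simp
  then have "x + x = 0"
    by (metis mult_2 mult_zero_left)
  then show ?thesis
    by (rule minus_unique)
qed

lemma CHAR_2_minus_eq_plus: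
  assumes "CHAR('a::comm_ring_1) = 2"
  shows "x - y = x + (y :: 'a)"
  using CHAR_2_uminus_eq[OF assms, of y] by (metis diff_conv_add_uminus)

lemma CHAR_2_power2_add:
  assumes "CHAR('a::comm_ring_1) = 2"
  shows "(x + y)\<^sup>2 = x\<^sup>2 + (y :: 'a)\<^sup>2"
proof -
  have "2 * x * y = x * y - - (x * y)" by simp
  also have "\<dots> = 0" by (simp add: CHAR_2_uminus_eq[OF assms, of "x * y"])
  finally show ?thesis by (simp add: power2_sum)
qed

lemma CHAR_2_power2_eq_iff:
  assumes "CHAR('a::idom) = 2"
  shows "x\<^sup>2 = (y :: 'a)\<^sup>2 \<longleftrightarrow> x = y"
  by (simp add: power2_eq_iff CHAR_2_uminus_eq[OF assms])

lemma power2_eq_self_iff: "x\<^sup>2 = x \<longleftrightarrow> x = 0 \<or> x = (1 :: 'a::idom)"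
  by (auto simp: power2_eq_square)

text \<open>Each row contains a zero, and a nonzero determinant keeps the two zeros out of a common
  column.\<close>

lemma monomial_2x2_cases:
  fixes p q r s :: "'a::idom"
  assumes "p * s \<noteq> q * r" "p * q = 0" "r * s = 0"
  obtains "q = 0" "r = 0" "p \<noteq> 0" "s \<noteq> 0" | "p = 0" "s = 0" "q \<noteq> 0" "r \<noteq> 0"
  using assms by auto

lemma Aut_E1:
  fixes b c :: "'a::field"
  assumes "b * c \<noteq> 1"
  shows "Aut (E\<^sub>1 b c) = (if b = c then {mat 1, mat2 0 1 1 0} else {mat 1})"
proof (rule mat2_set_eqI)
  fix p q r s :: 'a
  show "mat2 p q r s \<in> Aut (E\<^sub>1 b c) \<longleftrightarrow>
      mat2 p q r s \<in> (if b = c then {mat 1, mat2 0 1 1 0} else {mat 1})"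
  proof
    assume "mat2 p q r s \<in> Aut (E\<^sub>1 b c)"
    then have eqs: "p * s \<noteq> q * r" "p\<^sup>2 + b * r\<^sup>2 = p + c * q" "q\<^sup>2 + b * s\<^sup>2 = b * p + q"
        "c * p\<^sup>2 + r\<^sup>2 = r + c * s" "c * q\<^sup>2 + s\<^sup>2 = b * r + s"
        "p * q + b * r * s = 0" "c * p * q + r * s = 0"
      by (simp_all add: mem_Aut_simps)
    \<comment> \<open>The last two equations are a homogeneous linear system in p q and r s with
      determinant 1 - b c.\<close>
    have "(1 - b * c) * (p * q) = 0" "(1 - b * c) * (r * s) = 0"
      using eqs(6,7) by algebra+
    then have "p * q = 0" "r * s = 0" using assms by simp_all
    with eqs(1) show "mat2 p q r s \<in> (if b = c then {mat 1, mat2 0 1 1 0} else {mat 1})"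
    proof (cases rule: monomial_2x2_cases)
      case 1
      then show ?thesis using eqs(2,5) by (simp add: mat_1_eq_mat2 power2_eq_self_iff)
    next
      case 2
      then have "q = 1" "r = 1" using eqs(3,4) by (simp_all add: power2_eq_self_iff)
      \<comment> \<open>The equation left over now reads b = c, so the swap survives only for equal
        parameters.\<close>
      with 2 show ?thesis using eqs(2) by simp
    qed
  next
    assume "mat2 p q r s \<in> (if b = c then {mat 1, mat2 0 1 1 0} else {mat 1})"
    then show "mat2 p q r s \<in> Aut (E\<^sub>1 b c)"
      by (auto simp: mem_Aut_simps mat_1_eq_mat2 split: if_splits)
  qed
qed

lemma Aut_E2:
  fixes b :: "'a::field"
  assumes "b \<noteq> 0"
  shows "Aut (E\<^sub>2 b) = {mat 1}"
proof (rule mat2_set_eqI)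
  fix p q r s :: 'a
  show "mat2 p q r s \<in> Aut (E\<^sub>2 b) \<longleftrightarrow> mat2 p q r s \<in> {mat 1}"
  proof
    assume "mat2 p q r s \<in> Aut (E\<^sub>2 b)"
    then have eqs: "p * s \<noteq> q * r" "p\<^sup>2 + b * r\<^sup>2 = p + q" "p\<^sup>2 = r + s"
        "p * q = 0" "p * q + b * r * s = 0"
      by (auto simp: mem_Aut_simps)
    then have "r * s = 0" using assms by (metis add_0 mult.assoc mult_eq_0_iff)
    with eqs(1,4) show "mat2 p q r s \<in> {mat 1}"
    proof (cases rule: monomial_2x2_cases)
      case 1
      then show ?thesis using eqs(2,3) by (auto simp: mat_1_eq_mat2 power2_eq_self_iff)
    next
      case 2
      \<comment> \<open>An antidiagonal matrix would have r = 0 by the equation p^2 = r + s.\<close>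
      then show ?thesis using eqs(3) by simp
    qed
  qed (auto simp: mem_Aut_simps mat_1_eq_mat2)
qed

lemma Aut_E2_0: "Aut (E\<^sub>2 (0 :: 'a::field)) = {mat2 1 0 t (1 - t) | t. t \<noteq> 1}"
proof (rule mat2_set_eqI)
  fix p q r s :: 'a
  \<comment> \<open>Since e2 squares to 0, q^2 = 0. Then p^2 = p with p nonzero gives p = 1, and r +
    s = p^2 = 1.\<close>
  have "mat2 p q r s \<in> Aut (E\<^sub>2 0) \<longleftrightarrow> p = 1 \<and> q = 0 \<and> s \<noteq> 0 \<and> r + s = 1"
    by (auto simp: mem_Aut_simps power2_eq_self_iff)
  then show "mat2 p q r s \<in> Aut (E\<^sub>2 0) \<longleftrightarrow>
      mat2 p q r s \<in> {mat2 1 0 t (1 - t) | t. t \<noteq> 1}"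
    by (auto simp: eq_diff_eq add.commute)
qed

lemma Aut_E3:
  fixes t :: "'a::field"
  assumes t: "t\<^sup>2 + t + 1 = 0"
  shows "Aut E\<^sub>3 = {mat 1, mat2 0 1 1 0, mat2 t 0 0 (t\<^sup>2), mat2 (t\<^sup>2) 0 0 t,
                    mat2 0 t (t\<^sup>2) 0, mat2 0 (t\<^sup>2) t 0}" (is "_ = ?G")
proof (rule mat2_set_eqI)
  fix p q r s :: 'a
  have t4: "(t\<^sup>2)\<^sup>2 = t" using t by algebra
  have t0: "t \<noteq> 0" using t by auto
  \<comment> \<open>In both monomial cases the two nonzero entries are squares of each other, so
    each satisfies x^4 = x and is a cube root of unity.\<close>
  have roots: "x = 1 \<or> x = t \<or> x = t\<^sup>2" if "(x\<^sup>2)\<^sup>2 = x" "x \<noteq> 0" for x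
  proof -
    have "x * x ^ 3 = x * 1" using that(1) by (simp add: power2_eq_square power3_eq_cube mult.assoc)
    then show ?thesis using that(2) root_of_unity_quadratic_cube[OF t] by simp
  qed
  show "mat2 p q r s \<in> Aut E\<^sub>3 \<longleftrightarrow> mat2 p q r s \<in> ?G"
  proof
    assume "mat2 p q r s \<in> Aut E\<^sub>3"
    then have eqs: "p * s \<noteq> q * r" "p * q = 0" "r * s = 0"
        "r\<^sup>2 = q" "s\<^sup>2 = p" "p\<^sup>2 = s" "q\<^sup>2 = r"
      by (simp_all add: mem_Aut_simps)
    from eqs(1-3) show "mat2 p q r s \<in> ?G"
    proof (cases rule: monomial_2x2_cases)
      case 1
      then show ?thesis using roots[of p] eqs(5,6) t4 by (auto simp: mat_1_eq_mat2)
    next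
      case 2
      then show ?thesis using roots[of q] eqs(4,7) t4 by auto
    qed
  next
    assume "mat2 p q r s \<in> ?G"
    then show "mat2 p q r s \<in> Aut E\<^sub>3"
      using t4 t0 by (auto simp: mem_Aut_simps mat_1_eq_mat2)
  qed
qed

text \<open>The equations give r = 0, p = 1, q = 0 and s^2 = 1; injectivity of squaring leaves only
  s = 1.\<close>

lemma Aut_E4:
  assumes "CHAR('a::field) = 2"
  shows "Aut (E\<^sub>4 :: 'a^4^2) = {mat 1}"
proof (rule mat2_set_eqI)
  fix p q r s :: 'a
  show "mat2 p q r s \<in> Aut E\<^sub>4 \<longleftrightarrow> mat2 p q r s \<in> {mat 1}"
    using CHAR_2_power2_eq_iff[OF assms, of s 1]
    by (auto simp: mem_Aut_simps mat_1_eq_mat2 power2_eq_self_iff)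
qed

lemma Aut_E5:
  assumes char: "CHAR('a::field) = 2"
  shows "Aut (E\<^sub>5 :: 'a^4^2) = {mat2 t (1 - t) (1 - t) t | t. True}"
proof (rule mat2_set_eqI)
  fix p q r s :: 'a
  note char2 = CHAR_2_uminus_eq[OF char] CHAR_2_minus_eq_plus[OF char]
  have add_self: "x + x = 0" for x :: 'a
    by (metis char2(2) diff_self)
  \<comment> \<open>As -1 = 1, every nonzero structure constant is 1, and sums of two squares become
    squares of sums.\<close>
  have mem_iff: "mat2 p q r s \<in> Aut E\<^sub>5 \<longleftrightarrow> p * s \<noteq> q * r \<and>
      (p + r)\<^sup>2 = p + q \<and> (q + s)\<^sup>2 = p + q \<and> (p + r)\<^sup>2 = r + s \<and> (q + s)\<^sup>2 = r + s \<and>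
      p * q + r * s = 0"
    by (simp add: mem_Aut_simps char2 CHAR_2_power2_add[OF char])
  have "mat2 p q r s \<in> Aut E\<^sub>5 \<longleftrightarrow> q = 1 + p \<and> r = 1 + p \<and> s = p"
  proof
    assume "mat2 p q r s \<in> Aut E\<^sub>5"
    then have det: "p * s \<noteq> q * r"
      and eqs: "(p + r)\<^sup>2 = p + q" "(q + s)\<^sup>2 = p + q" "p * q + r * s = 0"
      by (simp_all add: mem_iff)
    have "p + r = q + s"
      using eqs(1,2) CHAR_2_power2_eq_iff[OF char] by metis
    then have "s = p + r - q" by simp
    then have s: "s = p + q + r" by (simp add: char2(2) add_ac)
    \<comment> \<open>After substituting s = p + q + r, both p q + r s and the determinant factor,
      the latter as (p + q) (p + r). Invertibility thus excludes p + r = 0 and leaves q + r =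
      0.\<close>
    have "(p + r) * (q + r) = 0"
      using eqs(3) s by algebra
    moreover have "(p + q) * (p + r) \<noteq> 0"
    proof
      assume "(p + q) * (p + r) = 0"
      then have "p * s = - (q * r)" using s by algebra
      then show False using det char2(1) by metis
    qed
    ultimately have "q + r = 0" "p + r \<noteq> 0" by auto
    then have "s = p" using s by (simp add: add.assoc)
    have "q = r" using \<open>q + r = 0\<close> char2(1) by (metis add_eq_0_iff2)
    then have "p + q = 1"
      using eqs(1) \<open>p + r \<noteq> 0\<close> by (simp add: power2_eq_self_iff)
    then have "q = 1 - p" by (simp add: eq_diff_eq add.commute)
    then have "q = 1 + p" by (simp only: char2(2))
    then show "q = 1 + p \<and> r = 1 + p \<and> s = p"
      using \<open>q = r\<close> \<open>s = p\<close> by simp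
  next
    assume *: "q = 1 + p \<and> r = 1 + p \<and> s = p"
    have "p + (1 + p) = 1" "1 + p + p = 1"
      using add_self[of p] by (simp_all only: add.assoc add.left_commute[of p 1] add_0_right)
    then have "p + q = 1" "r + s = 1" "p + r = 1" "q + s = 1"
      using * by simp_all
    moreover have "p * q + r * s = 0"
      using * add_self[of "p * (1 + p)"] by (simp only: mult.commute)
    \<comment> \<open>The determinant condition reads p^2 \<noteq> (1 + p)^2, which follows from
      injectivity of squaring.\<close>
    moreover have "p * s \<noteq> q * r"
      using * CHAR_2_power2_eq_iff[OF char, of p "1 + p"] by (simp add: power2_eq_square)
    ultimately show "mat2 p q r s \<in> Aut E\<^sub>5"
      unfolding mem_iff by simp
  qed
  then show "mat2 p q r s \<in> Aut E\<^sub>5 \<longleftrightarrow> mat2 p q r s \<in> {mat2 t (1 - t) (1 - t) t | t. True}"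
    by (auto simp: char2)
qed

text \<open>The relations reduce to r = 0 and p = s^2; q stays free, and the determinant is the cube
  of s.\<close>

lemma Aut_E6: "Aut (E\<^sub>6 :: 'a::field^4^2) = {mat2 (t\<^sup>2) s 0 t | t s. t \<noteq> 0}"
  by (intro mat2_set_eqI) (auto simp: mem_Aut_simps)

theorem theorem3p2:
  assumes "CHAR('a::alg_closed_field) = 2"
  shows "(\<forall>b c :: 'a. b * c \<noteq> 1 \<longrightarrow> b \<noteq> c \<longrightarrow> Aut (E\<^sub>1 b c) = {mat 1}) \<and>
    (\<forall>b :: 'a. b\<^sup>2 \<noteq> 1 \<longrightarrow> Aut (E\<^sub>1 b b) = {mat 1, mat2 0 1 1 0}) \<and>
    (\<forall>b :: 'a. b \<noteq> 0 \<longrightarrow> Aut (E\<^sub>2 b) = {mat 1}) \<and>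
    Aut (E\<^sub>2 (0 :: 'a)) = {mat2 1 0 t (1 - t) | t. t \<noteq> 1} \<and>
    (\<exists>t :: 'a. t\<^sup>2 + t + 1 = 0) \<and>
    (\<forall>t :: 'a. t\<^sup>2 + t + 1 = 0 \<longrightarrow>
      Aut E\<^sub>3 = {mat 1, mat2 0 1 1 0, mat2 t 0 0 (t\<^sup>2), mat2 (t\<^sup>2) 0 0 t,
                 mat2 0 t (t\<^sup>2) 0, mat2 0 (t\<^sup>2) t 0}) \<and>
    Aut (E\<^sub>4 :: 'a^4^2) = {mat 1} \<and>
    Aut (E\<^sub>5 :: 'a^4^2) = {mat2 t (1 - t) (1 - t) t | t. True} \<and>
    Aut (E\<^sub>6 :: 'a^4^2) = {mat2 (t\<^sup>2) s 0 t | t s. t \<noteq> 0}"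
proof (intro conjI allI impI)
  show "Aut (E\<^sub>1 b c) = {mat 1}" if "b * c \<noteq> 1" "b \<noteq> c" for b c :: 'a
    using Aut_E1[OF that(1)] that(2) by simp
  show "Aut (E\<^sub>1 b b) = {mat 1, mat2 0 1 1 0}" if "b\<^sup>2 \<noteq> 1" for b :: 'a
    using Aut_E1[of b b] that by (simp add: power2_eq_square)
  show "Aut (E\<^sub>4 :: 'a^4^2) = {mat 1}" by (rule Aut_E4[OF assms])
  show "Aut (E\<^sub>5 :: 'a^4^2) = {mat2 t (1 - t) (1 - t) t | t. True}" by (rule Aut_E5[OF assms])
qed (rule Aut_E2 Aut_E2_0 alg_closed_primitive_cube_root Aut_E3 Aut_E6; assumption)+

end
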